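(* Every bounded distributive lattice is a Gaussian semiring.
   Context: A semiring $(S,+,\cdot,0,1)$ is commutative: $(S,+,0)$ and $(S,\cdot,1)$ are commutative monoids, $1\neq 0$, multiplication distributes over addition, and $s\cdot 0=0$ for all $s$. An ideal is a nonempty subset closed under addition and under multiplication by elements of $S$. A bounded distributive lattice $L$ with least element $0$ and greatest element $1\neq 0$ is regarded as a semiring with join as addition and meet as multiplication. For $f\in S[X]$, $c(f)$ is the ideal of $S$ generated by the coefficients of $f$. The product $IJ$ of ideals is the set of finite sums of products $ab$ with $a\in I$, $b\in J$. A semiring $S$ is Gaussian if $c(fg)=c(f)c(g)$ for all $f,g\in S[X]$. *)

theory Defs
  imports "HOL-Computational_Algebra.Polynomial"
begin

text \<open>
  Commutative semirings are types of class \<^class>\<open>comm_semiring_1\<close>, which includes \<open>0 \<noteq> 1\<close>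
  and \<open>0 * a = 0\<close>.
\<close>

definition semiring_ideal :: "'a::comm_semiring_1 set \<Rightarrow> bool" where
  "semiring_ideal I \<longleftrightarrow>
     I \<noteq> {} \<and> (\<forall>a\<in>I. \<forall>b\<in>I. a + b \<in> I) \<and> (\<forall>s. \<forall>a\<in>I. s * a \<in> I)"

definition ideal_prod :: "'a::comm_semiring_1 set \<Rightarrow> 'a set \<Rightarrow> 'a set" where
  "ideal_prod I J =
     {\<Sum>i<n. a i * b i | (n::nat) a b. \<forall>i<n. a i \<in> I \<and> b i \<in> J}"

text \<open>
  \<^term>\<open>range (coeff f)\<close> always contains \<open>0\<close>; this does not affect the generated ideal, since every
  ideal contains \<open>0\<close>.
\<close>

definition content_ideal :: "'a::comm_semiring_1 poly \<Rightarrow> 'a set" where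
  "content_ideal f = semiring_ideal hull range (coeff f)"

definition gaussian_semiring :: "'a::comm_semiring_1 itself \<Rightarrow> bool" where
  "gaussian_semiring _ \<longleftrightarrow>
     (\<forall>f g :: 'a poly. content_ideal (f * g) = ideal_prod (content_ideal f) (content_ideal g))"

class bounded_distrib_lattice = distrib_lattice + bounded_lattice +
  assumes bot_neq_top: "bot \<noteq> top"

text \<open>
  The type \<open>'a lattice_semiring\<close> is a copy of the lattice \<open>'a\<close> carrying its semiring structure.
  The copy keeps the semiring operations apart from any arithmetic that \<open>'a\<close> may already have.
\<close>

typedef 'a lattice_semiring = "UNIV :: 'a set"
  morphisms of_lattice_semiring to_lattice_semiring ..

setup_lifting type_definition_lattice_semiring

instantiation lattice_semiring :: (bounded_distrib_lattice) comm_semiring_1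
begin

lift_definition zero_lattice_semiring :: "'a lattice_semiring" is bot .
lift_definition one_lattice_semiring :: "'a lattice_semiring" is top .
lift_definition plus_lattice_semiring ::
  "'a lattice_semiring \<Rightarrow> 'a lattice_semiring \<Rightarrow> 'a lattice_semiring" is sup .
lift_definition times_lattice_semiring ::
  "'a lattice_semiring \<Rightarrow> 'a lattice_semiring \<Rightarrow> 'a lattice_semiring" is inf .

instance
proof
  fix a b c :: "'a lattice_semiring"
  show "a + b + c = a + (b + c)" by transfer (rule sup_assoc)
  show "a + b = b + a" by transfer (rule sup_commute)
  show "0 + a = a" by transfer (rule sup_bot_left)
  show "a * b * c = a * (b * c)" by transfer (rule inf_assoc)
  show "a * b = b * a" by transfer (rule inf_commute)
  show "1 * a = a" by transfer (rule inf_top_left)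
  show "(a + b) * c = a * c + b * c" by transfer (rule inf_sup_distrib2)
  show "0 * a = 0" by transfer (rule inf_bot_left)
  show "a * 0 = 0" by transfer (rule inf_bot_right)
  show "(0::'a lattice_semiring) \<noteq> 1" by transfer (rule bot_neq_top)
qed

end

end

theory Submission
  imports Defs
begin

text \<open>
  Write \<open>f\<^sub>i\<close> and \<open>g\<^sub>j\<close> for the coefficients of \<open>f\<close> and \<open>g\<close>. The coefficient of \<open>fg\<close> in degree
  \<open>k\<close> is the sum of the products \<open>f\<^sub>i g\<^sub>j\<close> with \<open>i + j = k\<close>, so \<open>c(fg) \<subseteq> c(f)c(g)\<close> holds over every
  commutative semiring. The product \<open>c(f)c(g)\<close> is generated by the individual \<open>f\<^sub>i g\<^sub>j\<close>, so the
  reverse inclusion asks only that each of them be in \<open>c(fg)\<close>; over a ring this can fail, since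
  summands may cancel. In a lattice a summand lies below the join in which it occurs, that is, it is a
  multiple of that join by the absorption law \<open>x \<and> (x \<or> y) = x\<close>. Thus \<open>f\<^sub>i g\<^sub>j\<close> is a multiple of
  the coefficient of \<open>fg\<close> in degree \<open>i + j\<close>.
\<close>

lemma semiring_ideal_zero:
  assumes "semiring_ideal I"
  shows "0 \<in> I"
proof -
  obtain a where "a \<in> I"
    using assms unfolding semiring_ideal_def by blast
  then have "0 * a \<in> I"
    using assms unfolding semiring_ideal_def by blast
  then show ?thesis
    by simp
qed

lemma semiring_ideal_add:
  "semiring_ideal I \<Longrightarrow> a \<in> I \<Longrightarrow> b \<in> I \<Longrightarrow> a + b \<in> I"
  by (simp add: semiring_ideal_def)

lemma semiring_ideal_mult:
  "semiring_ideal I \<Longrightarrow> a \<in> I \<Longrightarrow> s * a \<in> I"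
  by (simp add: semiring_ideal_def)

lemma semiring_ideal_sum:
  assumes "semiring_ideal I" "\<And>x. x \<in> A \<Longrightarrow> h x \<in> I"
  shows "sum h A \<in> I"
  using assms(2)
  by (induction A rule: infinite_finite_induct)
     (auto intro: semiring_ideal_zero semiring_ideal_add assms(1))

lemma semiring_ideal_Inter:
  assumes "\<And>I. I \<in> F \<Longrightarrow> semiring_ideal I"
  shows "semiring_ideal (\<Inter>F)"
proof -
  have "0 \<in> \<Inter>F"
    using assms by (auto intro: semiring_ideal_zero)
  then show ?thesis
    unfolding semiring_ideal_def
    by (auto intro: semiring_ideal_add semiring_ideal_mult dest: assms)
qed

lemma semiring_ideal_content: "semiring_ideal (content_ideal f)"
  unfolding content_ideal_def by (rule hull_in, rule semiring_ideal_Inter, rule bspec)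

lemma coeff_in_content: "coeff f i \<in> content_ideal f"
  unfolding content_ideal_def by (rule hull_inc) simp

lemma content_ideal_minimal:
  assumes "semiring_ideal I" "\<And>i. coeff f i \<in> I"
  shows "content_ideal f \<subseteq> I"
  unfolding content_ideal_def using assms by (intro hull_minimal) auto

lemma sum_mult_in_ideal_prod:
  fixes n :: nat
  assumes "\<And>i. i < n \<Longrightarrow> a i \<in> I" "\<And>i. i < n \<Longrightarrow> b i \<in> J"
  shows "(\<Sum>i<n. a i * b i) \<in> ideal_prod I J"
  unfolding ideal_prod_def using assms
  by (intro CollectI exI[of _ n] exI[of _ a] exI[of _ b]) simp

lemma mult_in_ideal_prod:
  assumes "a \<in> I" "b \<in> J"
  shows "a * b \<in> ideal_prod I J"
  using sum_mult_in_ideal_prod[of 1 "\<lambda>_. a" I "\<lambda>_. b" J] assms by simp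

lemma semiring_ideal_ideal_prod:
  assumes "semiring_ideal I"
  shows "semiring_ideal (ideal_prod I J)"
  unfolding semiring_ideal_def
proof (intro conjI ballI allI)
  show "ideal_prod I J \<noteq> {}"
    unfolding ideal_prod_def by (auto intro: exI[of _ 0])
next
  fix x y assume "x \<in> ideal_prod I J" "y \<in> ideal_prod I J"
  then obtain m n :: nat and a b a' b' where
    x: "x = (\<Sum>i<m. a i * b i)" "\<forall>i<m. a i \<in> I \<and> b i \<in> J" and
    y: "y = (\<Sum>i<n. a' i * b' i)" "\<forall>i<n. a' i \<in> I \<and> b' i \<in> J"
    unfolding ideal_prod_def by blast
  define a'' where "a'' i = (if i < m then a i else a' (i - m))" for i
  define b'' where "b'' i = (if i < m then b i else b' (i - m))" for i
  have "(\<Sum>i<m + n. a'' i * b'' i) = (\<Sum>i<m. a'' i * b'' i) + (\<Sum>i<n. a'' (m + i) * b'' (m + i))"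
    by (induction n) (simp_all add: add.assoc)
  also have "\<dots> = x + y"
    by (simp add: x(1) y(1) a''_def b''_def)
  finally have "x + y = (\<Sum>i<m + n. a'' i * b'' i)" ..
  also have "\<dots> \<in> ideal_prod I J"
    using x(2) y(2) by (intro sum_mult_in_ideal_prod) (auto simp: a''_def b''_def)
  finally show "x + y \<in> ideal_prod I J" .
next
  fix s x assume "x \<in> ideal_prod I J"
  then obtain n :: nat and a b where
    x: "x = (\<Sum>i<n. a i * b i)" "\<forall>i<n. a i \<in> I \<and> b i \<in> J"
    unfolding ideal_prod_def by blast
  have "s * x = (\<Sum>i<n. (s * a i) * b i)"
    by (simp add: x(1) sum_distrib_left mult.assoc)
  also have "\<dots> \<in> ideal_prod I J"
    using x(2) by (intro sum_mult_in_ideal_prod) (simp_all add: semiring_ideal_mult[OF assms])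
  finally show "s * x \<in> ideal_prod I J" .
qed

lemma ideal_prod_minimal:
  assumes "semiring_ideal K" "\<And>a b. a \<in> I \<Longrightarrow> b \<in> J \<Longrightarrow> a * b \<in> K"
  shows "ideal_prod I J \<subseteq> K"
  unfolding ideal_prod_def using assms by (auto intro!: semiring_ideal_sum)

text \<open>
  The ideal quotient \<open>(K : B)\<close>. It lets membership of all products \<open>a b\<close> in \<open>K\<close> be checked on
  generators, one factor at a time.
\<close>

lemma semiring_ideal_quotient:
  assumes "semiring_ideal K"
  shows "semiring_ideal {a. \<forall>b\<in>B. a * b \<in> K}"
  unfolding semiring_ideal_def
proof (intro conjI ballI allI)
  have "0 \<in> {a. \<forall>b\<in>B. a * b \<in> K}"
    using semiring_ideal_zero[OF assms] by simp
  then show "{a. \<forall>b\<in>B. a * b \<in> K} \<noteq> {}"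
    by blast
qed (simp_all add: distrib_right mult.assoc semiring_ideal_add[OF assms] semiring_ideal_mult[OF assms])

lemma content_mult_subset: "content_ideal (f * g) \<subseteq> ideal_prod (content_ideal f) (content_ideal g)"
proof (rule content_ideal_minimal)
  show ideal: "semiring_ideal (ideal_prod (content_ideal f) (content_ideal g))"
    by (intro semiring_ideal_ideal_prod semiring_ideal_content)
  show "coeff (f * g) k \<in> ideal_prod (content_ideal f) (content_ideal g)" for k
    unfolding coeff_mult
    by (intro semiring_ideal_sum ideal mult_in_ideal_prod coeff_in_content)
qed

lemma ideal_prod_content_subset:
  assumes "semiring_ideal K" "\<And>i j. coeff f i * coeff g j \<in> K"
  shows "ideal_prod (content_ideal f) (content_ideal g) \<subseteq> K"
proof (rule ideal_prod_minimal[OF assms(1)])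
  have "content_ideal f \<subseteq> {a. \<forall>b\<in>range (coeff g). a * b \<in> K}"
    using assms by (intro content_ideal_minimal semiring_ideal_quotient) auto
  then have "content_ideal g \<subseteq> {b. \<forall>a\<in>content_ideal f. b * a \<in> K}"
    using assms(1)
    by (intro content_ideal_minimal semiring_ideal_quotient) (auto simp: mult.commute)
  then show "a * b \<in> K" if "a \<in> content_ideal f" "b \<in> content_ideal g" for a b
    using that by (auto simp: mult.commute)
qed

text \<open>
  Absorption makes each summand of a coefficient of \<open>f * g\<close> a multiple of that coefficient, so the
  summands lie in the content of \<open>f * g\<close>.
\<close>

lemma gaussian_semiring_if_absorption:
  assumes absorb: "\<And>x y :: 'a::comm_semiring_1. x * (x + y) = x"
  shows "gaussian_semiring TYPE('a)"
  unfolding gaussian_semiring_def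
proof (intro allI equalityI content_mult_subset ideal_prod_content_subset semiring_ideal_content)
  fix f g :: "'a poly" and i j
  let ?x = "coeff f i * coeff g j"
  have "coeff (f * g) (i + j) = ?x + (\<Sum>l\<in>{..i + j} - {i}. coeff f l * coeff g (i + j - l))"
    unfolding coeff_mult by (subst sum.remove[of _ i]) auto
  then have "?x = ?x * coeff (f * g) (i + j)"
    by (simp only: absorb)
  also have "\<dots> \<in> content_ideal (f * g)"
    by (intro semiring_ideal_mult semiring_ideal_content coeff_in_content)
  finally show "?x \<in> content_ideal (f * g)" .
qed

theorem theorem9:
  shows "gaussian_semiring TYPE('a::bounded_distrib_lattice lattice_semiring)"
proof (rule gaussian_semiring_if_absorption)
  show "x * (x + y) = x" for x y :: "'a lattice_semiring"
    by transfer (rule inf_sup_absorb)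
qed

end
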